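(* Let $\mathcal{M}$ be a smooth manifold and let $K, L$ be a pair of disjoint distributions on $\mathcal{M}$ of equal constant rank (it is not assumed that $T\mathcal{M} = K \oplus L$). Let $\bar K, \bar L$ be fixed complements of $K, L$ respectively in $T\mathcal{M}$, so $T\mathcal{M} = K\oplus\bar K = L\oplus \bar L$, with $K \subset \bar L$ and $L \subset \bar K$. Let $P_K$ be the projector onto $K$ with kernel $\bar K$ and $P_L$ the projector onto $L$ with kernel $\bar L$. Let $S$ be a $K$-endomorphism, i.e. a $K$-valued $1$-form on $T\mathcal{M}$ (a $(1,1)$ tensor field) with $\ker(S) = \bar L$ and $\operatorname{im}(S) = K$, and let $Q$ be the unique $L$-valued $1$-form with $\ker(Q) = \bar K$, $\operatorname{im}(Q) = L$, $Q\circ S = P_L$ and $S \circ Q = P_K$. Then the operators $\nabla^K$ and $\nabla^L$ on $K$ and $L$ respectively defined by \[ \nabla^K_X Y := S([X, Q(Y)]), \quad X, Y \in K; \qquad \nabla^L_X Y := Q([X, S(Y)]), \quad X, Y \in L, \] have the covariant derivative properties over $\mathfrak{F}(\mathcal{M})$.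
   Context: $\mathfrak{F}(\mathcal{M})$ is the ring of smooth functions on $\mathcal{M}$, and everything is smooth. A distribution $D$ is identified with the $\mathfrak{F}(\mathcal{M})$-submodule of vector fields taking values in $D$, so "$X \in K$" means that $X$ is a vector field with values in $K$. Disjoint means intersecting pointwise only in $0$. $[\cdot,\cdot]$ is the Lie bracket of vector fields. An operator $\nabla^D$, assigning to $X, Y \in D$ a vector field $\nabla^D_X Y$ on $\mathcal{M}$, has the covariant derivative properties over $\mathfrak{F}(\mathcal{M})$ if it is $\mathbb{R}$-linear in both arguments and, for all $X, Y \in D$ and $f \in \mathfrak{F}(\mathcal{M})$, $\nabla^D_{fX} Y = f \nabla^D_X Y$ and $\nabla^D_X (fY) = X(f) Y + f \nabla^D_X Y$. *)

theory Defs
  imports "HOL-Analysis.Analysis" "HOL-Library.Function_Algebras"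
begin

text \<open>Real-valued functionals, and sections of spaces of functionals, form real vector spaces
  under the pointwise operations. The additive part is provided by
  \<^theory>\<open>HOL-Library.Function_Algebras\<close>.\<close>

instantiation "fun" :: (type, real_vector) real_vector
begin

definition scaleR_fun :: "real \<Rightarrow> ('a \<Rightarrow> 'b) \<Rightarrow> 'a \<Rightarrow> 'b" where
  "scaleR_fun c f = (\<lambda>x. c *\<^sub>R f x)"

instance
  by standard (simp_all add: scaleR_fun_def fun_eq_iff scaleR_add_left scaleR_add_right)

end

subsection \<open>Smooth manifolds\<close>

primrec higher_differentiable_on ::
  "'a::real_normed_vector set \<Rightarrow> ('a \<Rightarrow> 'b::real_normed_vector) \<Rightarrow> nat \<Rightarrow> bool" where
  "higher_differentiable_on S f 0 \<longleftrightarrow> continuous_on S f"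
| "higher_differentiable_on S f (Suc n) \<longleftrightarrow>
     (\<forall>x\<in>S. f differentiable (at x)) \<and>
     (\<forall>v. higher_differentiable_on S (\<lambda>x. frechet_derivative f (at x) v) n)"

text \<open>Only used for open sets of finite-dimensional spaces, where it means that all iterated
  directional derivatives exist and are continuous.\<close>

definition smooth_on ::
  "'a::real_normed_vector set \<Rightarrow> ('a \<Rightarrow> 'b::real_normed_vector) \<Rightarrow> bool" where
  "smooth_on S f \<longleftrightarrow> (\<forall>n. higher_differentiable_on S f n)"

type_synonym ('m, 'e) chart = "'m set \<times> ('m \<Rightarrow> 'e)"

definition is_chart :: "('m::topological_space, 'e::real_normed_vector) chart \<Rightarrow> bool" where
  "is_chart c \<longleftrightarrow> (case c of (U, \<phi>) \<Rightarrow>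
     open U \<and> open (\<phi> ` U) \<and> homeomorphism U (\<phi> ` U) \<phi> (inv_into U \<phi>))"

text \<open>The underlying space is the whole type \<open>'m\<close>. The model space is any finite-dimensional
  normed space rather than a Euclidean space, because the latter class excludes dimension 0.\<close>

definition smooth_manifold ::
  "('m::{t2_space,second_countable_topology}, 'e::real_normed_vector) chart set \<Rightarrow> bool" where
  "smooth_manifold A \<longleftrightarrow>
     (\<exists>B::'e set. finite B \<and> span B = UNIV) \<and>
     (\<forall>c\<in>A. is_chart c) \<and>
     (\<Union>(U, \<phi>)\<in>A. U) = UNIV \<and>
     (\<forall>(U, \<phi>)\<in>A. \<forall>(V, \<psi>)\<in>A. smooth_on (\<phi> ` (U \<inter> V)) (\<psi> \<circ> inv_into U \<phi>))"

definition smooth_fun_on ::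
  "('m::topological_space, 'e::real_normed_vector) chart set \<Rightarrow> 'm set \<Rightarrow> ('m \<Rightarrow> real) \<Rightarrow> bool" where
  "smooth_fun_on A W f \<longleftrightarrow> (\<forall>(U, \<phi>)\<in>A. smooth_on (\<phi> ` (U \<inter> W)) (f \<circ> inv_into U \<phi>))"

definition smooth_functions ::
  "('m::topological_space, 'e::real_normed_vector) chart set \<Rightarrow> ('m \<Rightarrow> real) set" where
  "smooth_functions A = {f. smooth_fun_on A UNIV f}"

subsection \<open>Tangent vectors and vector fields\<close>

type_synonym 'm tangent = "('m \<Rightarrow> real) \<Rightarrow> real"
type_synonym 'm vfield = "'m \<Rightarrow> 'm tangent"

text \<open>Tangent vectors at \<open>p\<close> are the derivations at \<open>p\<close> of the algebra of smooth
  functions. A derivation is extended by 0 to non-smooth arguments, so that equality of tangent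
  vectors is equality of functionals.\<close>

definition tangent_space ::
  "('m::topological_space, 'e::real_normed_vector) chart set \<Rightarrow> 'm \<Rightarrow> 'm tangent set" where
  "tangent_space A p = {v.
     (\<forall>f. f \<notin> smooth_functions A \<longrightarrow> v f = 0) \<and>
     (\<forall>f\<in>smooth_functions A. \<forall>g\<in>smooth_functions A. v (\<lambda>x. f x + g x) = v f + v g) \<and>
     (\<forall>c. \<forall>f\<in>smooth_functions A. v (\<lambda>x. c * f x) = c * v f) \<and>
     (\<forall>f\<in>smooth_functions A. \<forall>g\<in>smooth_functions A.
        v (\<lambda>x. f x * g x) = f p * v g + g p * v f)}"

definition act :: "'m vfield \<Rightarrow> ('m \<Rightarrow> real) \<Rightarrow> 'm \<Rightarrow> real" where
  "act X f = (\<lambda>p. X p f)"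

definition vector_fields_on ::
  "('m::topological_space, 'e::real_normed_vector) chart set \<Rightarrow> 'm set \<Rightarrow> 'm vfield set" where
  "vector_fields_on A W = {X.
     (\<forall>p\<in>W. X p \<in> tangent_space A p) \<and>
     (\<forall>f\<in>smooth_functions A. smooth_fun_on A W (act X f))}"

definition vector_fields ::
  "('m::topological_space, 'e::real_normed_vector) chart set \<Rightarrow> 'm vfield set" where
  "vector_fields A = vector_fields_on A UNIV"

definition fmult :: "('m \<Rightarrow> real) \<Rightarrow> 'm vfield \<Rightarrow> 'm vfield" where
  "fmult f X = (\<lambda>p. f p *\<^sub>R X p)"

definition lie_bracket :: "'m vfield \<Rightarrow> 'm vfield \<Rightarrow> 'm vfield" where
  "lie_bracket X Y = (\<lambda>p f. X p (act Y f) - Y p (act X f))"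

subsection \<open>Distributions\<close>

type_synonym 'm distribution = "'m \<Rightarrow> 'm tangent set"

definition smooth_distribution ::
  "('m::topological_space, 'e::real_normed_vector) chart set \<Rightarrow> nat \<Rightarrow> 'm distribution \<Rightarrow> bool" where
  "smooth_distribution A k D \<longleftrightarrow>
     (\<forall>p. D p \<subseteq> tangent_space A p \<and> subspace (D p) \<and> dim (D p) = k) \<and>
     (\<forall>p. \<exists>W X. open W \<and> p \<in> W \<and> (\<forall>i<k. X i \<in> vector_fields_on A W) \<and>
        (\<forall>q\<in>W. D q = span ((\<lambda>i. X i q) ` {..<k})))"

definition sections ::
  "('m::topological_space, 'e::real_normed_vector) chart set \<Rightarrow> 'm distribution \<Rightarrow> 'm vfield set" where
  "sections A D = {X \<in> vector_fields A. \<forall>p. X p \<in> D p}"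

definition disjoint_distributions :: "'m distribution \<Rightarrow> 'm distribution \<Rightarrow> bool" where
  "disjoint_distributions D E \<longleftrightarrow> (\<forall>p. D p \<inter> E p = {0})"

definition complement_of ::
  "('m::topological_space, 'e::real_normed_vector) chart set \<Rightarrow> 'm distribution \<Rightarrow> 'm distribution \<Rightarrow> bool" where
  "complement_of A D E \<longleftrightarrow>
     (\<exists>m. smooth_distribution A m E) \<and>
     disjoint_distributions D E \<and>
     (\<forall>p. tangent_space A p = {u + w |u w. u \<in> D p \<and> w \<in> E p})"

subsection \<open>Fields of endomorphisms of the tangent bundle\<close>

type_synonym 'm endo = "'m \<Rightarrow> 'm tangent \<Rightarrow> 'm tangent"

definition endo_app :: "'m endo \<Rightarrow> 'm vfield \<Rightarrow> 'm vfield" where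
  "endo_app T X = (\<lambda>p. T p (X p))"

definition tensor_field_1_1 ::
  "('m::topological_space, 'e::real_normed_vector) chart set \<Rightarrow> 'm endo \<Rightarrow> bool" where
  "tensor_field_1_1 A T \<longleftrightarrow>
     (\<forall>p. \<forall>v\<in>tangent_space A p. T p v \<in> tangent_space A p) \<and>
     (\<forall>p. \<forall>v\<in>tangent_space A p. \<forall>w\<in>tangent_space A p. T p (v + w) = T p v + T p w) \<and>
     (\<forall>p c. \<forall>v\<in>tangent_space A p. T p (c *\<^sub>R v) = c *\<^sub>R T p v) \<and>
     (\<forall>X\<in>vector_fields A. endo_app T X \<in> vector_fields A)"

definition endo_ker ::
  "('m::topological_space, 'e::real_normed_vector) chart set \<Rightarrow> 'm endo \<Rightarrow> 'm distribution" where
  "endo_ker A T = (\<lambda>p. {v \<in> tangent_space A p. T p v = 0})"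

definition endo_im ::
  "('m::topological_space, 'e::real_normed_vector) chart set \<Rightarrow> 'm endo \<Rightarrow> 'm distribution" where
  "endo_im A T = (\<lambda>p. T p ` tangent_space A p)"

text \<open>The projector onto \<open>D\<close> with kernel \<open>E\<close>; meaningful on tangent vectors if
  \<open>E\<close> is a complement of \<open>D\<close>.\<close>

definition projector :: "'m distribution \<Rightarrow> 'm distribution \<Rightarrow> 'm endo" where
  "projector D E = (\<lambda>p v. THE u. u \<in> D p \<and> (\<exists>w\<in>E p. v = u + w))"

subsection \<open>Covariant derivative properties\<close>

definition covariant_derivative_properties ::
  "('m::topological_space, 'e::real_normed_vector) chart set \<Rightarrow> 'm distribution \<Rightarrow>
   ('m vfield \<Rightarrow> 'm vfield \<Rightarrow> 'm vfield) \<Rightarrow> bool" where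
  "covariant_derivative_properties A D N \<longleftrightarrow>
     (\<forall>X\<in>sections A D. \<forall>Y\<in>sections A D. N X Y \<in> vector_fields A) \<and>
     (\<forall>X\<in>sections A D. \<forall>X'\<in>sections A D. \<forall>Y\<in>sections A D. N (X + X') Y = N X Y + N X' Y) \<and>
     (\<forall>c. \<forall>X\<in>sections A D. \<forall>Y\<in>sections A D. N (c *\<^sub>R X) Y = c *\<^sub>R N X Y) \<and>
     (\<forall>X\<in>sections A D. \<forall>Y\<in>sections A D. \<forall>Y'\<in>sections A D. N X (Y + Y') = N X Y + N X Y') \<and>
     (\<forall>c. \<forall>X\<in>sections A D. \<forall>Y\<in>sections A D. N X (c *\<^sub>R Y) = c *\<^sub>R N X Y) \<and>
     (\<forall>f\<in>smooth_functions A. \<forall>X\<in>sections A D. \<forall>Y\<in>sections A D.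
        N (fmult f X) Y = fmult f (N X Y)) \<and>
     (\<forall>f\<in>smooth_functions A. \<forall>X\<in>sections A D. \<forall>Y\<in>sections A D.
        N X (fmult f Y) = fmult (act X f) Y + fmult f (N X Y))"

end

theory Submission
  imports Defs
begin

text \<open>The Leibniz rules of the Lie bracket are \<open>[fX, Z] = f[X, Z] - Z(f) X\<close> and
  \<open>[X, fZ] = f[X, Z] + X(f) Z\<close>. With \<open>Z = Q(Y)\<close>, applying \<open>S\<close> removes the term
  \<open>Z(f) X\<close>, since \<open>K\<close> lies in the kernel of \<open>S\<close>, and turns \<open>X(f) Q(Y)\<close> into \<open>X(f) Y\<close>,
  since \<open>S \<circ> Q\<close> is the identity on \<open>K\<close>. The same argument applies with \<open>(K, S)\<close> and
  \<open>(L, Q)\<close> exchanged.\<close>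

section \<open>Iterated differentiability on open sets: locality, sums and products\<close>

lemma higher_differentiable_on_cong:
  assumes "open S" "\<And>x. x \<in> S \<Longrightarrow> f x = g x" "higher_differentiable_on S f n"
  shows "higher_differentiable_on S g n"
  using assms(2,3)
proof (induction n arbitrary: f g)
  case 0
  then show ?case by (simp cong: continuous_on_cong)
next
  case (Suc n)
  \<comment> \<open>Since \<open>S\<close> is open, \<open>f\<close> and \<open>g\<close> agree near
    each point of \<open>S\<close>, so a derivative of one there is a derivative of the other.
    Agreement on \<open>S\<close> thus passes to the directional derivatives, which feeds the
    induction.\<close>
  have D: "(g has_derivative frechet_derivative f (at x)) (at x)" if "x \<in> S" for x
    using Suc.prems that assms(1)
    by (auto simp: frechet_derivative_works intro: has_derivative_transform_within_open)
  then have "frechet_derivative g (at x) = frechet_derivative f (at x)" if "x \<in> S" for x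
    using that frechet_derivative_at by metis
  with Suc have "higher_differentiable_on S (\<lambda>x. frechet_derivative g (at x) v) n" for v
    by (auto intro: Suc.IH[of "\<lambda>x. frechet_derivative f (at x) v"])
  with D show ?case by (auto simp: differentiable_def)
qed

lemma higher_differentiable_on_SucD:
  "higher_differentiable_on S f (Suc n) \<Longrightarrow> higher_differentiable_on S f n"
proof (induction n arbitrary: f)
  case 0
  then show ?case
    by (auto intro!: continuous_at_imp_continuous_on differentiable_imp_continuous_within)
next
  case (Suc n)
  from Suc.prems have "\<forall>x\<in>S. f differentiable (at x)"
    and "\<And>v. higher_differentiable_on S (\<lambda>x. frechet_derivative f (at x) v) (Suc n)"
    by simp_all
  then show ?case using Suc.IH by simp
qed

text \<open>The induction runs over all constants because the derivative of a constant is the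
  constant 0.\<close>

lemma higher_differentiable_on_const: "higher_differentiable_on S (\<lambda>x. c) n"
  by (induction n arbitrary: c) simp_all

lemma higher_differentiable_on_add:
  assumes "open S" "higher_differentiable_on S f n" "higher_differentiable_on S g n"
  shows "higher_differentiable_on S (\<lambda>x. f x + g x) n"
  using assms(2,3)
proof (induction n arbitrary: f g)
  case 0
  then show ?case by (simp add: continuous_on_add)
next
  case (Suc n)
  have eq: "frechet_derivative (\<lambda>x. f x + g x) (at x) v
      = frechet_derivative f (at x) v + frechet_derivative g (at x) v" if "x \<in> S" for x v
    using Suc.prems that
    by (subst frechet_derivative_at[symmetric])
       (auto simp: frechet_derivative_works intro: has_derivative_add)
  have d: "higher_differentiable_on S
      (\<lambda>x. frechet_derivative f (at x) v + frechet_derivative g (at x) v) n" for v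
    using Suc.prems by (intro Suc.IH) simp_all
  \<comment> \<open>The sum rule for \<open>frechet_derivative\<close> is known only at points of
    \<open>S\<close>, so it is transferred by the congruence lemma and not by rewriting the whole
    function.\<close>
  have "higher_differentiable_on S
      (\<lambda>x. frechet_derivative (\<lambda>x. f x + g x) (at x) v) n" for v
    by (rule higher_differentiable_on_cong[OF assms(1) _ d[of v]]) (simp add: eq)
  with Suc.prems show ?case by simp
qed

lemma higher_differentiable_on_mult:
  fixes f g :: "'a::real_normed_vector \<Rightarrow> 'b::real_normed_algebra"
  assumes "open S" "higher_differentiable_on S f n" "higher_differentiable_on S g n"
  shows "higher_differentiable_on S (\<lambda>x. f x * g x) n"
  using assms(2,3)
proof (induction n arbitrary: f g)
  case 0
  then show ?case by (simp add: continuous_on_mult)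
next
  case (Suc n)
  have D: "((\<lambda>x. f x * g x) has_derivative
      (\<lambda>v. f x * frechet_derivative g (at x) v + frechet_derivative f (at x) v * g x)) (at x)"
    if "x \<in> S" for x
    using Suc.prems that by (auto simp: frechet_derivative_works intro!: has_derivative_mult)
  then have eq: "frechet_derivative (\<lambda>x. f x * g x) (at x) v
      = f x * frechet_derivative g (at x) v + frechet_derivative f (at x) v * g x"
    if "x \<in> S" for x v
    using that by (subst frechet_derivative_at[symmetric]) auto
  \<comment> \<open>In the product rule each summand pairs an undifferentiated factor with a
    derivative. The former is available at order \<open>Suc n\<close> and must be lowered to
    \<open>n\<close> before the induction hypothesis applies.\<close>
  have d: "higher_differentiable_on S
      (\<lambda>x. f x * frechet_derivative g (at x) v + frechet_derivative f (at x) v * g x) n" for v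
    using Suc.prems higher_differentiable_on_SucD[OF Suc.prems(1)]
      higher_differentiable_on_SucD[OF Suc.prems(2)]
    by (intro higher_differentiable_on_add[OF assms(1)] Suc.IH) simp_all
  have "higher_differentiable_on S
      (\<lambda>x. frechet_derivative (\<lambda>x. f x * g x) (at x) v) n" for v
    by (rule higher_differentiable_on_cong[OF assms(1) _ d[of v]]) (simp add: eq)
  moreover have "\<forall>x\<in>S. (\<lambda>x. f x * g x) differentiable (at x)"
    using D by (auto simp: differentiable_def)
  ultimately show ?case by simp
qed

section \<open>The ring of smooth functions\<close>

lemma open_chart_image:
  assumes "smooth_manifold A" "(U, \<phi>) \<in> A"
  shows "open (\<phi> ` U)"
  using assms by (auto simp: smooth_manifold_def is_chart_def)

lemma smooth_functions_const: "(\<lambda>x. c) \<in> smooth_functions A"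
  by (auto simp: smooth_functions_def smooth_fun_on_def smooth_on_def o_def
      higher_differentiable_on_const)

lemma smooth_functions_add:
  assumes "smooth_manifold A" "f \<in> smooth_functions A" "g \<in> smooth_functions A"
  shows "(\<lambda>x. f x + g x) \<in> smooth_functions A"
  using assms
  by (fastforce simp: smooth_functions_def smooth_fun_on_def smooth_on_def o_def
      intro!: higher_differentiable_on_add open_chart_image)

lemma smooth_functions_mult:
  assumes "smooth_manifold A" "f \<in> smooth_functions A" "g \<in> smooth_functions A"
  shows "(\<lambda>x. f x * g x) \<in> smooth_functions A"
  using assms
  by (fastforce simp: smooth_functions_def smooth_fun_on_def smooth_on_def o_def
      intro!: higher_differentiable_on_mult open_chart_image)

lemma smooth_functions_diff:
  assumes "smooth_manifold A" "f \<in> smooth_functions A" "g \<in> smooth_functions A"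
  shows "(\<lambda>x. f x - g x) \<in> smooth_functions A"
  using smooth_functions_add[OF assms(1,2)
      smooth_functions_mult[OF assms(1) smooth_functions_const assms(3), of "-1"]]
  by simp

section \<open>Tangent vectors and vector fields as derivations\<close>

lemma tangent_nonsmooth: "v \<in> tangent_space A p \<Longrightarrow> f \<notin> smooth_functions A \<Longrightarrow> v f = 0"
  by (simp add: tangent_space_def)

lemma tangent_add:
  "\<lbrakk>v \<in> tangent_space A p; f \<in> smooth_functions A; g \<in> smooth_functions A\<rbrakk>
    \<Longrightarrow> v (\<lambda>x. f x + g x) = v f + v g"
  by (simp add: tangent_space_def)

lemma tangent_cmult:
  "\<lbrakk>v \<in> tangent_space A p; f \<in> smooth_functions A\<rbrakk> \<Longrightarrow> v (\<lambda>x. c * f x) = c * v f"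
  by (simp add: tangent_space_def)

lemma tangent_mult:
  "\<lbrakk>v \<in> tangent_space A p; f \<in> smooth_functions A; g \<in> smooth_functions A\<rbrakk>
    \<Longrightarrow> v (\<lambda>x. f x * g x) = f p * v g + g p * v f"
  by (simp add: tangent_space_def)

lemma tangent_zero: "v \<in> tangent_space A p \<Longrightarrow> v (\<lambda>x. 0) = 0"
  using tangent_cmult[OF _ smooth_functions_const, of v A p 0] by simp

lemma vector_fields_tangent: "X \<in> vector_fields A \<Longrightarrow> X p \<in> tangent_space A p"
  by (simp add: vector_fields_def vector_fields_on_def)

lemma act_smooth:
  "X \<in> vector_fields A \<Longrightarrow> f \<in> smooth_functions A \<Longrightarrow> act X f \<in> smooth_functions A"
  by (simp add: vector_fields_def vector_fields_on_def smooth_functions_def)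

lemma act_nonsmooth:
  "X \<in> vector_fields A \<Longrightarrow> f \<notin> smooth_functions A \<Longrightarrow> act X f = (\<lambda>p. 0)"
  by (simp add: act_def tangent_nonsmooth[OF vector_fields_tangent])

text \<open>Extension by 0 makes this hold for every \<open>f\<close>: a non-smooth \<open>f\<close>
  is sent to the zero function. Bracket identities can therefore be checked on arbitrary functionals
  without a case distinction.\<close>

lemma act_in_smooth_functions:
  "X \<in> vector_fields A \<Longrightarrow> act X f \<in> smooth_functions A"
  by (cases "f \<in> smooth_functions A") (simp_all add: act_smooth act_nonsmooth smooth_functions_const)

lemma act_add:
  "\<lbrakk>X \<in> vector_fields A; f \<in> smooth_functions A; g \<in> smooth_functions A\<rbrakk>
    \<Longrightarrow> act X (\<lambda>x. f x + g x) = (\<lambda>x. act X f x + act X g x)"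
  unfolding act_def by (simp add: tangent_add[OF vector_fields_tangent])

lemma act_cmult:
  "\<lbrakk>X \<in> vector_fields A; f \<in> smooth_functions A\<rbrakk>
    \<Longrightarrow> act X (\<lambda>x. c * f x) = (\<lambda>x. c * act X f x)"
  unfolding act_def by (simp add: tangent_cmult[OF vector_fields_tangent])

lemma act_mult:
  "\<lbrakk>X \<in> vector_fields A; f \<in> smooth_functions A; g \<in> smooth_functions A\<rbrakk>
    \<Longrightarrow> act X (\<lambda>x. f x * g x) = (\<lambda>x. f x * act X g x + g x * act X f x)"
  unfolding act_def by (simp add: tangent_mult[OF vector_fields_tangent])

section \<open>The Lie bracket, its Leibniz rules, and constants\<close>

lemma lie_bracket_tangent:
  assumes M: "smooth_manifold A" and X: "X \<in> vector_fields A" and Y: "Y \<in> vector_fields A"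
  shows "lie_bracket X Y p \<in> tangent_space A p"
proof -
  note XY = vector_fields_tangent[OF X] vector_fields_tangent[OF Y]
  note act_smooth[OF X, simp] act_smooth[OF Y, simp] smooth_functions_mult[OF M, simp]
  show ?thesis
    unfolding tangent_space_def lie_bracket_def
  proof (intro CollectI conjI allI impI ballI)
    \<comment> \<open>Both inner actions give the zero function, which every tangent vector kills.
      So the bracket respects the extension by 0.\<close>
    fix f assume "f \<notin> smooth_functions A"
    then show "X p (act Y f) - Y p (act X f) = 0"
      using X Y by (simp add: act_nonsmooth XY[THEN tangent_zero])
  next
    fix f g assume "f \<in> smooth_functions A" "g \<in> smooth_functions A"
    then show "X p (act Y (\<lambda>x. f x + g x)) - Y p (act X (\<lambda>x. f x + g x))
        = X p (act Y f) - Y p (act X f) + (X p (act Y g) - Y p (act X g))"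
      by (simp add: act_add[OF X] act_add[OF Y] XY[THEN tangent_add])
  next
    fix c f assume "f \<in> smooth_functions A"
    then show "X p (act Y (\<lambda>x. c * f x)) - Y p (act X (\<lambda>x. c * f x))
        = c * (X p (act Y f) - Y p (act X f))"
      by (simp add: act_cmult[OF X] act_cmult[OF Y] XY[THEN tangent_cmult] algebra_simps)
  next
    fix f g assume "f \<in> smooth_functions A" "g \<in> smooth_functions A"
    then show "X p (act Y (\<lambda>x. f x * g x)) - Y p (act X (\<lambda>x. f x * g x))
        = f p * (X p (act Y g) - Y p (act X g)) + g p * (X p (act Y f) - Y p (act X f))"
      \<comment> \<open>Both orders of differentiation produce the same mixed terms X(f) Y(g) + X(g)
        Y(f), which cancel in the commutator. Only the derivation terms remain.\<close>
      by (simp add: act_mult[OF X] act_mult[OF Y] XY[THEN tangent_add] XY[THEN tangent_mult])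
         (simp add: act_def algebra_simps)
  qed
qed

lemma lie_bracket_vector_field:
  assumes M: "smooth_manifold A" and X: "X \<in> vector_fields A" and Y: "Y \<in> vector_fields A"
  shows "lie_bracket X Y \<in> vector_fields A"
proof -
  have "act (lie_bracket X Y) f = (\<lambda>x. act X (act Y f) x - act Y (act X f) x)" for f
    by (simp add: act_def lie_bracket_def)
  then have "smooth_fun_on A UNIV (act (lie_bracket X Y) f)" if "f \<in> smooth_functions A" for f
    using smooth_functions_diff[OF M] act_smooth[OF X] act_smooth[OF Y] that
    by (simp add: smooth_functions_def)
  with lie_bracket_tangent[OF assms] show ?thesis
    by (simp add: vector_fields_def vector_fields_on_def)
qed

text \<open>Antisymmetry, used to derive the rules in the right argument from those in the
  left.\<close>

lemma lie_bracket_commute: "lie_bracket Y X = (- 1) *\<^sub>R lie_bracket X Y"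
  by (simp add: fun_eq_iff lie_bracket_def scaleR_fun_def)

lemma lie_bracket_add_left:
  assumes "X \<in> vector_fields A" "X' \<in> vector_fields A" "Z \<in> vector_fields A"
  shows "lie_bracket (X + X') Z = lie_bracket X Z + lie_bracket X' Z"
proof (intro ext)
  fix p f
  have "act (X + X') f = (\<lambda>x. act X f x + act X' f x)"
    by (simp add: act_def)
  then show "lie_bracket (X + X') Z p f = (lie_bracket X Z + lie_bracket X' Z) p f"
    using assms
    by (simp add: lie_bracket_def tangent_add[OF vector_fields_tangent] act_in_smooth_functions)
qed

text \<open>The correction term arises when \<open>Z\<close> acts as a derivation on the product f
  X(g). The identity is stated at a point so that a fibrewise linear map can be applied to it
  directly.\<close>

lemma lie_bracket_fmult_left:
  assumes X: "X \<in> vector_fields A" and Z: "Z \<in> vector_fields A" and f: "f \<in> smooth_functions A"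
  shows "lie_bracket (fmult f X) Z p
    = f p *\<^sub>R lie_bracket X Z p + (- act Z f p) *\<^sub>R X p"
proof
  fix g
  have "act (fmult f X) g = (\<lambda>x. f x * act X g x)"
    by (simp add: act_def fmult_def scaleR_fun_def)
  moreover have "Z p (\<lambda>x. f x * act X g x) = f p * Z p (act X g) + act X g p * Z p f"
    using tangent_mult[OF vector_fields_tangent[OF Z] f act_in_smooth_functions[OF X]] .
  ultimately show "lie_bracket (fmult f X) Z p g
      = (f p *\<^sub>R lie_bracket X Z p + (- act Z f p) *\<^sub>R X p) g"
    by (simp add: lie_bracket_def fmult_def scaleR_fun_def act_def algebra_simps)
qed

lemma lie_bracket_add_right:
  assumes "X \<in> vector_fields A" "Z \<in> vector_fields A" "Z' \<in> vector_fields A"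
  shows "lie_bracket X (Z + Z') = lie_bracket X Z + lie_bracket X Z'"
  using lie_bracket_add_left[OF assms(2,3,1)]
  by (simp add: lie_bracket_commute[of X] scaleR_add_right)

lemma lie_bracket_fmult_right:
  assumes "X \<in> vector_fields A" "Z \<in> vector_fields A" "f \<in> smooth_functions A"
  shows "lie_bracket X (fmult f Z) p = f p *\<^sub>R lie_bracket X Z p + act X f p *\<^sub>R Z p"
  using lie_bracket_fmult_left[OF assms(2,1,3), of p]
  by (simp add: lie_bracket_commute[of X] fun_eq_iff scaleR_fun_def algebra_simps)

text \<open>Reduces homogeneity over the reals to the rules for multiplication by smooth
  functions.\<close>

lemma scaleR_eq_fmult: "c *\<^sub>R X = fmult (\<lambda>x. c) X"
  by (simp add: fmult_def scaleR_fun_def)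

text \<open>The Leibniz rule on 1 = 1 * 1 gives X(1) = 2 X(1), hence X(1) = 0; a general constant is
  c * 1.\<close>

lemma act_const:
  assumes "X \<in> vector_fields A"
  shows "act X (\<lambda>x. c) = (\<lambda>x. 0)"
proof
  fix p
  note v = vector_fields_tangent[OF assms, of p]
  have "X p (\<lambda>x. 1) = 0"
    using tangent_mult[OF v smooth_functions_const smooth_functions_const, of 1 1] by simp
  then show "act X (\<lambda>x. c) p = 0"
    using tangent_cmult[OF v smooth_functions_const, of c 1] by (simp add: act_def)
qed

section \<open>Tensor fields of type (1,1) and the covariant derivative they induce\<close>

lemma tensor_add:
  "\<lbrakk>tensor_field_1_1 A T; v \<in> tangent_space A p; w \<in> tangent_space A p\<rbrakk>
    \<Longrightarrow> T p (v + w) = T p v + T p w"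
  by (simp add: tensor_field_1_1_def)

lemma tensor_scaleR:
  "\<lbrakk>tensor_field_1_1 A T; v \<in> tangent_space A p\<rbrakk> \<Longrightarrow> T p (c *\<^sub>R v) = c *\<^sub>R T p v"
  by (simp add: tensor_field_1_1_def)

lemma tensor_vector_field:
  "\<lbrakk>tensor_field_1_1 A T; X \<in> vector_fields A\<rbrakk> \<Longrightarrow> endo_app T X \<in> vector_fields A"
  by (simp add: tensor_field_1_1_def)

lemma tangent_scaleR:
  "v \<in> tangent_space A p \<Longrightarrow> c *\<^sub>R v \<in> tangent_space A p"
  by (simp add: tangent_space_def scaleR_fun_def algebra_simps)

lemma endo_app_add:
  assumes "tensor_field_1_1 A T" "X \<in> vector_fields A" "Y \<in> vector_fields A"
  shows "endo_app T (X + Y) = endo_app T X + endo_app T Y"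
  using assms by (simp add: fun_eq_iff endo_app_def tensor_add vector_fields_tangent)

lemma endo_app_fmult:
  assumes "tensor_field_1_1 A T" "X \<in> vector_fields A"
  shows "endo_app T (fmult f X) = fmult f (endo_app T X)"
  using tensor_scaleR[OF assms(1) vector_fields_tangent[OF assms(2)]]
  by (simp add: endo_app_def fmult_def)

text \<open>Isolates what both operators share, so that one argument serves twice: for
  \<open>K\<close> with the pair \<open>S\<close>, \<open>Q\<close>, and for \<open>L\<close> with
  the two tensors exchanged.\<close>

lemma covariant_derivative_of_transfer:
  assumes M: "smooth_manifold A"
    and S: "tensor_field_1_1 A S" and Q: "tensor_field_1_1 A Q"
    and S_D: "\<And>p v. v \<in> D p \<Longrightarrow> S p v = 0"
    and SQ_D: "\<And>p v. v \<in> D p \<Longrightarrow> S p (Q p v) = v"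
  shows "covariant_derivative_properties A D
    (\<lambda>X Y. endo_app S (lie_bracket X (endo_app Q Y)))"
proof -
  define N where "N X Y = endo_app S (lie_bracket X (endo_app Q Y))" for X Y
  have V: "X \<in> vector_fields A" if "X \<in> sections A D" for X
    using that by (simp add: sections_def)
  have D: "X p \<in> D p" if "X \<in> sections A D" for X p
    using that by (simp add: sections_def)
  note QV = tensor_vector_field[OF Q V]
  note LV = lie_bracket_vector_field[OF M]
  have N_fmult_left: "N (fmult f X) Y = fmult f (N X Y)"
    if f: "f \<in> smooth_functions A" and X: "X \<in> sections A D" and Y: "Y \<in> sections A D" for f X Y
  proof
    fix p
    note t = vector_fields_tangent[OF LV[OF V[OF X] QV[OF Y]], of p]
      vector_fields_tangent[OF V[OF X], of p]
    show "N (fmult f X) Y p = fmult f (N X Y) p"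
      \<comment> \<open>Instantiating \<open>endo_app_def\<close> at \<open>S\<close> keeps
        \<open>endo_app Q Y\<close> folded, as the vector field to which the bracket rule is
        applied.\<close>
      unfolding N_def endo_app_def[of S] fmult_def[of f "\<lambda>p. S p _"]
        lie_bracket_fmult_left[OF V[OF X] QV[OF Y] f]
      \<comment> \<open>The simplification rule for minus is removed so that the correction term
        stays a scalar multiple of \<open>X p\<close>, the form on which linearity of
        \<open>S\<close> can act.\<close>
      by (simp add: tensor_add[OF S] tensor_scaleR[OF S] tangent_scaleR t S_D[OF D[OF X]] fmult_def
          del: scaleR_minus_left)
  qed
  have N_fmult_right: "N X (fmult f Y) = fmult (act X f) Y + fmult f (N X Y)"
    if f: "f \<in> smooth_functions A" and X: "X \<in> sections A D" and Y: "Y \<in> sections A D" for f X Y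
  proof
    fix p
    note t = vector_fields_tangent[OF LV[OF V[OF X] QV[OF Y]], of p]
      vector_fields_tangent[OF QV[OF Y], of p]
    have "S p (endo_app Q Y p) = Y p"
      using SQ_D[OF D[OF Y]] by (simp add: endo_app_def)
    then show "N X (fmult f Y) p = (fmult (act X f) Y + fmult f (N X Y)) p"
      unfolding N_def endo_app_fmult[OF Q V[OF Y]] endo_app_def[of S]
        lie_bracket_fmult_right[OF V[OF X] QV[OF Y] f]
      by (simp add: tensor_add[OF S] tensor_scaleR[OF S] tangent_scaleR t fmult_def)
  qed
  have "covariant_derivative_properties A D N"
    unfolding covariant_derivative_properties_def
  proof (intro conjI ballI allI)
    fix X Y assume "X \<in> sections A D" "Y \<in> sections A D"
    then show "N X Y \<in> vector_fields A"
      unfolding N_def by (intro tensor_vector_field[OF S] LV V QV)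
  next
    fix X X' Y assume "X \<in> sections A D" "X' \<in> sections A D" "Y \<in> sections A D"
    then show "N (X + X') Y = N X Y + N X' Y"
      by (simp add: N_def lie_bracket_add_left[OF V V QV] endo_app_add[OF S] LV V QV)
  next
    fix X Y Y' assume "X \<in> sections A D" "Y \<in> sections A D" "Y' \<in> sections A D"
    then show "N X (Y + Y') = N X Y + N X Y'"
      by (simp add: N_def endo_app_add[OF Q] lie_bracket_add_right[OF V QV QV]
          endo_app_add[OF S] LV V QV)
  next
    fix c X Y assume "X \<in> sections A D" "Y \<in> sections A D"
    then show "N (c *\<^sub>R X) Y = c *\<^sub>R N X Y"
      by (simp add: scaleR_eq_fmult N_fmult_left smooth_functions_const)
  next
    fix c X Y assume "X \<in> sections A D" "Y \<in> sections A D"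
    then show "N X (c *\<^sub>R Y) = c *\<^sub>R N X Y"
      \<comment> \<open>The Leibniz term vanishes because the derivative of a constant is 0.\<close>
      by (simp add: scaleR_eq_fmult N_fmult_right smooth_functions_const act_const[OF V])
         (simp add: fmult_def fun_eq_iff scaleR_fun_def)
  qed (simp_all add: N_fmult_left N_fmult_right)
  then show ?thesis by (simp add: N_def[abs_def])
qed

section \<open>Projectors fix their image; the two connections\<close>

lemma projector_eq_self:
  assumes D: "smooth_distribution A k D" and E: "complement_of A D E" and v: "v \<in> D p"
  shows "projector D E p v = v"
proof -
  from E obtain m where "smooth_distribution A m E"
    by (auto simp: complement_of_def)
  then have E': "subspace (E p)" by (auto simp: smooth_distribution_def)
  from D have D': "subspace (D p)" by (auto simp: smooth_distribution_def)
  from E have DE: "D p \<inter> E p = {0}"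
    by (auto simp: complement_of_def disjoint_distributions_def)
  show ?thesis
    unfolding projector_def
  proof (rule the_equality)
    show "v \<in> D p \<and> (\<exists>w\<in>E p. v = v + w)"
      using v subspace_0[OF E'] by force
  next
    fix u assume u: "u \<in> D p \<and> (\<exists>w\<in>E p. v = u + w)"
    \<comment> \<open>The difference is the component \<open>w\<close> in \<open>E p\<close>, and it
      also lies in \<open>D p\<close> because both \<open>u\<close> and \<open>v\<close> do.\<close>
    then have "v - u \<in> D p \<inter> E p" using v subspace_diff[OF D'] by auto
    then show "u = v" using DE by simp
  qed
qed

theorem theorem3p1:
  fixes A :: "('m::{t2_space,second_countable_topology}, 'e::real_normed_vector) chart set"
    and k :: nat
    and K L Kbar Lbar :: "'m distribution"
    and S Q :: "'m endo"
  assumes manifold: "smooth_manifold A"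
    and K: "smooth_distribution A k K"
    and L: "smooth_distribution A k L"
    and disjoint: "disjoint_distributions K L"
    and Kbar: "complement_of A K Kbar"
    and Lbar: "complement_of A L Lbar"
    and K_sub: "\<And>p. K p \<subseteq> Lbar p"
    and L_sub: "\<And>p. L p \<subseteq> Kbar p"
    and S: "tensor_field_1_1 A S" "endo_ker A S = Lbar" "endo_im A S = K"
    and Q: "tensor_field_1_1 A Q" "endo_ker A Q = Kbar" "endo_im A Q = L"
    and QS: "\<And>p v. v \<in> tangent_space A p \<Longrightarrow> Q p (S p v) = projector L Lbar p v"
    and SQ: "\<And>p v. v \<in> tangent_space A p \<Longrightarrow> S p (Q p v) = projector K Kbar p v"
  shows "covariant_derivative_properties A K (\<lambda>X Y. endo_app S (lie_bracket X (endo_app Q Y))) \<and>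
         covariant_derivative_properties A L (\<lambda>X Y. endo_app Q (lie_bracket X (endo_app S Y)))"
proof -
  have "S p v = 0 \<and> S p (Q p v) = v" if v: "v \<in> K p" for v p
  proof -
    \<comment> \<open>Kernel membership gives both the vanishing of \<open>S\<close> on
      \<open>v\<close> and the tangency of \<open>v\<close>, which is what \<open>SQ\<close> asks
      for.\<close>
    from v K_sub have "v \<in> endo_ker A S p" unfolding S(2) by blast
    with SQ projector_eq_self[OF K Kbar v] show ?thesis by (simp add: endo_ker_def)
  qed
  moreover have "Q p v = 0 \<and> Q p (S p v) = v" if v: "v \<in> L p" for v p
  proof -
    from v L_sub have "v \<in> endo_ker A Q p" unfolding Q(2) by blast
    with QS projector_eq_self[OF L Lbar v] show ?thesis by (simp add: endo_ker_def)
  qed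
  ultimately show ?thesis
    by (intro conjI covariant_derivative_of_transfer[OF manifold S(1) Q(1)]
        covariant_derivative_of_transfer[OF manifold Q(1) S(1)]) simp_all
qed

end
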